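(* Let $N\geq 2$ be an integer and let $a\in(-\infty,0)\cup(0,1)$. Then there exists a constant $C_{N,a}>0$, depending only on $N$ and $a$, such that $$\int_{\mathbb R^N}\left|\nabla\left(\frac{u(x)}{|x|}\right)\right|^N|x|^a\,\mathrm dx\leq C_{N,a}\int_{\mathbb R^N}\left|D^2u(x)\right|^N|x|^a\,\mathrm dx$$ for all $u\in C^\infty_c(\mathbb R^N\setminus\{0\})$.
   Context: $C^\infty_c(\mathbb R^N\setminus\{0\})$ denotes the smooth real-valued functions whose support is a compact subset of $\mathbb R^N\setminus\{0\}$. $|x|$ is the Euclidean norm, $D^2u(x)$ is the Hessian matrix of $u$ at $x$, and $|D^2u(x)|$ is its Euclidean (Frobenius) norm. *)

theory Defs
  imports "HOL-Analysis.Analysis"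
begin

definition partial_deriv :: "'n \<Rightarrow> (real ^ 'n \<Rightarrow> real) \<Rightarrow> real ^ 'n \<Rightarrow> real"
  where "partial_deriv i f x = frechet_derivative f (at x) (axis i 1)"

definition grad :: "(real ^ 'n \<Rightarrow> real) \<Rightarrow> real ^ 'n \<Rightarrow> real ^ 'n"
  where "grad f x = (\<chi> i. partial_deriv i f x)"

text \<open>The norm of the type \<^typ>\<open>real ^ 'n ^ 'n\<close> is the Euclidean norm of the vector of Euclidean
  norms of the rows, so \<^term>\<open>norm\<close> of the Hessian is its Frobenius norm.\<close>

definition hessian :: "(real ^ 'n \<Rightarrow> real) \<Rightarrow> real ^ 'n \<Rightarrow> real ^ 'n ^ 'n"
  where "hessian f x = (\<chi> i j. partial_deriv i (partial_deriv j f) x)"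

primrec Ck :: "nat \<Rightarrow> (real ^ 'n \<Rightarrow> real) \<Rightarrow> bool"
  where
    "Ck 0 f \<longleftrightarrow> continuous_on UNIV f"
  | "Ck (Suc k) f \<longleftrightarrow> f differentiable_on UNIV \<and> (\<forall>i. Ck k (partial_deriv i f))"

definition support :: "(real ^ 'n \<Rightarrow> real) \<Rightarrow> (real ^ 'n) set"
  where "support f = closure {x. f x \<noteq> 0}"

text \<open>A function in \<open>C\<^sub>c\<^sup>\<infinity>\<close> of the punctured space is represented by its extension by zero to the
  whole space. The closure in \<^const>\<open>support\<close> is taken in the whole space, so requiring it to be
  compact and not to contain the origin makes the support a compact subset of the punctured
  space, and the extension is smooth exactly when the original function is.\<close>

definition test_functions_punctured :: "(real ^ 'n \<Rightarrow> real) set"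
  where "test_functions_punctured =
    {u. (\<forall>k. Ck k u) \<and> compact (support u) \<and> support u \<subseteq> UNIV - {0}}"

lemma GDERIV_grad:
  assumes "f differentiable (at x)"
  shows "GDERIV f x :> grad f x"
proof -
  have D: "(f has_derivative frechet_derivative f (at x)) (at x)"
    using assms by (simp add: frechet_derivative_works)
  then interpret L: bounded_linear "frechet_derivative f (at x)"
    by (rule has_derivative_bounded_linear)
  have "frechet_derivative f (at x) h = inner h (grad f x)" for h
  proof -
    have "frechet_derivative f (at x) h = frechet_derivative f (at x) (\<Sum>i\<in>UNIV. h $ i *\<^sub>R axis i 1)"
      by (simp add: basis_expansion flip: scalar_mult_eq_scaleR)
    also have "\<dots> = inner h (grad f x)"
      by (simp add: L.sum L.scaleR grad_def partial_deriv_def inner_vec_def)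
    finally show ?thesis .
  qed
  then have "frechet_derivative f (at x) = (\<lambda>h. inner h (grad f x))"
    by blast
  with D show ?thesis by (simp add: gderiv_def)
qed

lemma norm_hessian_frobenius:
  "norm (hessian f x) = sqrt (\<Sum>i\<in>UNIV. \<Sum>j\<in>UNIV. (partial_deriv i (partial_deriv j f) x)\<^sup>2)"
  by (simp add: hessian_def norm_vec_def L2_set_def sum_nonneg)

end

theory Submission
  imports Defs
begin

text \<open>For \<open>c + N \<noteq> 0\<close>, Hardy's inequality
  \<open>\<integral>|x|\<^sup>c |w|\<^sup>p \<le> C \<integral>|x|\<^sup>c\<^sup>+\<^sup>p |\<nabla>w|\<^sup>p\<close> holds on the punctured space. It follows from
  the Euler identity \<open>\<integral> x \<cdot> \<nabla>f = - N \<integral> f\<close>, obtained by differentiating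
  \<open>\<integral> f(t x) dx = t\<^sup>-\<^sup>N \<integral> f\<close> at \<open>t = 1\<close>, applied to \<open>f = |x|\<^sup>c |w|\<^sup>p\<close>.

  Since \<open>|\<nabla>(u/|x|)| \<le> |\<nabla>u|/|x| + |u|/|x|\<^sup>2\<close>, it suffices to use it with \<open>p = N\<close>:
  for \<open>u\<close> with \<open>c = a - 2N\<close>, where \<open>c + N = a - N < 0\<close>, and for each \<open>\<partial>\<^sub>i u\<close> with
  \<open>c = a - N\<close>, where \<open>c + N = a \<noteq> 0\<close>.\<close>

section \<open>Gradients and derivatives along rays\<close>

lemma GDERIV_imp_grad_eq:
  assumes "GDERIV f x :> D"
  shows "grad f x = D"
  using frechet_derivative_at[OF assms[unfolded gderiv_def], symmetric]
  by (simp add: grad_def partial_deriv_def vec_eq_iff inner_axis')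

lemma GDERIV_imp_radial_deriv:
  assumes "GDERIV f x :> D"
  shows "((\<lambda>t. f (t *\<^sub>R x)) has_real_derivative inner x D) (at 1)"
proof -
  have f: "(f has_derivative (\<lambda>h. inner h D)) (at ((1::real) *\<^sub>R x))"
    using assms by (simp add: gderiv_def)
  have "((\<lambda>t::real. t *\<^sub>R x) has_derivative (\<lambda>t. t *\<^sub>R x)) (at 1)"
    by (auto intro!: derivative_eq_intros)
  from has_derivative_compose[OF this f] show ?thesis
    by (simp add: has_field_derivative_def mult_commute_abs)
qed

section \<open>Dilations and the Euler identity for integrals\<close>

lemma integral_scaleR_lborel:
  fixes f :: "'a::euclidean_space \<Rightarrow> real"
  assumes "t > 0" "f \<in> borel_measurable borel"
  shows "(LINT x|lborel. f (t *\<^sub>R x)) = inverse t ^ DIM('a) * (LINT x|lborel. f x)"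
proof -
  have [measurable]: "f \<in> borel_measurable borel" by fact
  have *: "lborel = density (distr lborel borel (\<lambda>x::'a. t *\<^sub>R x)) (\<lambda>_. ennreal (t ^ DIM('a)))"
    using lborel_affine[of t "0::'a"] assms by (simp add: ennreal_power)
  have "(LINT x|lborel. f x) = t ^ DIM('a) * (LINT x|lborel. f (t *\<^sub>R x))"
    using assms by (subst *, subst integral_density) (auto simp: integral_distr)
  then show ?thesis using assms by (simp add: field_simps)
qed

lemma integrable_continuous_compact_support:
  fixes f :: "'a::euclidean_space \<Rightarrow> real"
  assumes "continuous_on UNIV f" "compact S" "\<And>x. x \<notin> S \<Longrightarrow> f x = 0"
  shows "integrable lborel f"
proof -
  have "integrable lborel (\<lambda>x. indicator S x *\<^sub>R f x)"
    using assms by (intro borel_integrable_compact) (auto intro: continuous_on_subset)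
  also have "(\<lambda>x. indicator S x *\<^sub>R f x) = f"
    using assms(3) by (auto simp: indicator_def fun_eq_iff)
  finally show ?thesis .
qed

text \<open>Supplies the dominating constant for differentiating a dilated integral. The mean value
  point \<open>z\<close> on the ray exceeds 1, so the factor \<open>1 / z\<close> only shrinks the
  derivative.\<close>

lemma radial_difference_quotient_bound:
  fixes f g :: "'a::euclidean_space \<Rightarrow> real"
  assumes rad: "\<And>x. ((\<lambda>t. f (t *\<^sub>R x)) has_real_derivative g x) (at 1)"
    and M: "\<And>x. \<bar>g x\<bar> \<le> M" and "h > 0"
  shows "\<bar>(f ((1 + h) *\<^sub>R x) - f x) / h\<bar> \<le> M"
proof -
  \<comment> \<open>The hypothesis only concerns the parameter 1, but for all points. Using it at
    \<open>s *\<^sub>R x\<close> and reparametrising by \<open>r = t / s\<close> gives the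
    derivative at every positive parameter.\<close>
  have D: "((\<lambda>s. f (s *\<^sub>R x)) has_real_derivative g (s *\<^sub>R x) / s) (at s)" if "s > 0" for s
  proof -
    have 1: "((\<lambda>r. f (r *\<^sub>R (s *\<^sub>R x))) has_real_derivative g (s *\<^sub>R x)) (at (s / s))"
      using rad[of "s *\<^sub>R x"] that by simp
    have 2: "((\<lambda>r. r / s) has_real_derivative 1 / s) (at s)"
      using that by (auto intro!: derivative_eq_intros)
    show ?thesis using DERIV_chain2[OF 1 2] that by simp
  qed
  have "\<exists>z>1. z < 1 + h \<and> f ((1 + h) *\<^sub>R x) - f (1 *\<^sub>R x) = (1 + h - 1) * (g (z *\<^sub>R x) / z)"
    using \<open>h > 0\<close> by (intro MVT2 D) auto
  then obtain z where "z > 1" "f ((1 + h) *\<^sub>R x) - f x = h * (g (z *\<^sub>R x) / z)" by auto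
  moreover have "\<bar>g (z *\<^sub>R x) / z\<bar> \<le> \<bar>g (z *\<^sub>R x)\<bar>"
    using \<open>z > 1\<close> by (simp add: divide_le_eq mult_le_cancel_left1)
  ultimately show ?thesis using M[of "z *\<^sub>R x"] \<open>h > 0\<close> by simp
qed

text \<open>Both sides are the derivative at \<open>t = 1\<close> of the integral of the dilated
  function: the left by dominated convergence, the right by the scaling rule.\<close>

lemma integral_radial_deriv:
  fixes f g :: "'a::euclidean_space \<Rightarrow> real"
  assumes f: "continuous_on UNIV f" and g: "continuous_on UNIV g"
    and S: "compact S" "\<And>x. x \<notin> S \<Longrightarrow> f x = 0" "\<And>x. x \<notin> S \<Longrightarrow> g x = 0"
    and rad: "\<And>x. ((\<lambda>t. f (t *\<^sub>R x)) has_real_derivative g x) (at 1)"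
  shows "(LINT x|lborel. g x) = - real DIM('a) * (LINT x|lborel. f x)"
proof -
  obtain R where R: "R > 0" "\<And>x. x \<in> S \<Longrightarrow> norm x \<le> R"
    using compact_imp_bounded[OF S(1)] by (auto simp: bounded_pos)
  obtain M where M: "\<And>x. x \<in> S \<Longrightarrow> \<bar>g x\<bar> \<le> M" and "M > 0"
    using compact_imp_bounded[OF compact_continuous_image[OF continuous_on_subset[OF g] S(1)]]
    by (auto simp: bounded_pos)
  have M: "\<bar>g x\<bar> \<le> M" for x using M[of x] S(3)[of x] \<open>M > 0\<close> by (cases "x \<in> S") auto
  \<comment> \<open>Positive increments are chosen: they allow the mean value bound, and dilation by
    a factor above 1 never brings a point outside the ball back into \<open>S\<close>.\<close>
  define h where "h k = inverse (real (Suc k))" for k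
  have hpos: "h k > 0" for k by (simp add: h_def)
  have h: "filterlim h (at 0) sequentially"
    unfolding filterlim_at using LIMSEQ_inverse_real_of_nat by (simp add: h_def [abs_def])
  have fm [measurable]: "f \<in> borel_measurable borel" "g \<in> borel_measurable borel"
    using f g by (auto intro: borel_measurable_continuous_onI)
  have fi: "integrable lborel f" by (rule integrable_continuous_compact_support[OF f S(1,2)])
  define q where "q k x = (f ((1 + h k) *\<^sub>R x) - f x) / h k" for k x
  have [measurable]: "q k \<in> borel_measurable borel" for k
    unfolding q_def[abs_def] by measurable
  have lim: "(\<lambda>k. integral\<^sup>L lborel (q k)) \<longlonglongrightarrow> integral\<^sup>L lborel g"
  proof (rule integral_dominated_convergence[where w="\<lambda>x. M * indicator (cball 0 R) x"])
    show "integrable lborel (\<lambda>x::'a. M * indicator (cball 0 R) x)"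
      using emeasure_lborel_cball_finite[of "0::'a" R]
      by (intro integrable_mult_right integrable_real_indicator) (auto simp: less_top)
    show "AE x in lborel. (\<lambda>k. q k x) \<longlonglongrightarrow> g x"
    proof (rule AE_I2)
      fix x
      have "((\<lambda>e. (f ((1 + e) *\<^sub>R x) - f (1 *\<^sub>R x)) / e) \<longlongrightarrow> g x) (at 0)"
        using rad[of x] by (simp only: DERIV_def)
      from filterlim_compose[OF this h] show "(\<lambda>k. q k x) \<longlonglongrightarrow> g x"
        by (simp add: q_def)
    qed
    show "AE x in lborel. norm (q k x) \<le> M * indicator (cball 0 R) x" for k
    proof (rule AE_I2)
      fix x
      show "norm (q k x) \<le> M * indicator (cball 0 R) x"
      proof (cases "norm x \<le> R")
        case True
        then show ?thesis
          using radial_difference_quotient_bound[OF rad M hpos[of k]] by (simp add: q_def)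
      next
        case False
        \<comment> \<open>Both \<open>x\<close> and its dilate lie outside the ball of radius
          \<open>R\<close>, so both terms of the quotient vanish.\<close>
        have "norm ((1 + h k) *\<^sub>R x) = (1 + h k) * norm x" using hpos[of k] by simp
        also have "\<dots> \<ge> 1 * norm x" using hpos[of k] by (intro mult_right_mono) auto
        finally have "x \<notin> S" "(1 + h k) *\<^sub>R x \<notin> S" using False R(2) by force+
        then show ?thesis using False S(2) by (simp add: q_def)
      qed
    qed
  qed auto
  \<comment> \<open>By scaling, the integral of \<open>q k\<close> is a difference quotient of the
    map taking \<open>t\<close> to \<open>inverse t ^ DIM('a)\<close>. The form \<open>1 + 0\<close>
    matches the quotient used for its derivative below.\<close>
  have eq: "integral\<^sup>L lborel (q k) =
      ((inverse (1 + h k)) ^ DIM('a) - (inverse (1 + 0)) ^ DIM('a)) / h k * integral\<^sup>L lborel f" for k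
  proof -
    have pos: "1 + h k > 0" using hpos[of k] by simp
    have "integrable lborel (\<lambda>x. f ((1 + h k) *\<^sub>R x))"
    proof (rule integrable_continuous_compact_support)
      show "continuous_on UNIV (\<lambda>x. f ((1 + h k) *\<^sub>R x))"
        by (intro continuous_on_compose2[OF f] continuous_intros) auto
      show "compact ((\<lambda>x. inverse (1 + h k) *\<^sub>R x) ` S)" using S(1) by (rule compact_scaling)
      show "f ((1 + h k) *\<^sub>R x) = 0" if "x \<notin> (\<lambda>x. inverse (1 + h k) *\<^sub>R x) ` S" for x
      proof (rule S(2), rule notI)
        assume "(1 + h k) *\<^sub>R x \<in> S"
        from imageI[OF this, of "\<lambda>x. inverse (1 + h k) *\<^sub>R x"] that pos show False by simp
      qed
    qed
    then show ?thesis
      using fi integral_scaleR_lborel[OF pos fm(1)]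
      by (simp add: q_def[abs_def] algebra_simps)
  qed
  have "(\<lambda>k. ((inverse (1 + h k)) ^ DIM('a) - (inverse (1 + 0)) ^ DIM('a)) / h k
      * integral\<^sup>L lborel f) \<longlonglongrightarrow> - real DIM('a) * integral\<^sup>L lborel f"
  proof (intro tendsto_mult_right)
    have "((\<lambda>t::real. inverse t ^ DIM('a)) has_real_derivative - real DIM('a)) (at (1 + 0))"
      by (rule derivative_eq_intros refl | simp)+
    then have "((\<lambda>e::real. (inverse (1 + e) ^ DIM('a) - inverse (1 + 0) ^ DIM('a)) / e)
        \<longlongrightarrow> - real DIM('a)) (at 0)"
      by (simp add: DERIV_def)
    from filterlim_compose[OF this h]
    show "(\<lambda>k. (inverse (1 + h k) ^ DIM('a) - inverse (1 + 0) ^ DIM('a)) / h k)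
        \<longlonglongrightarrow> - real DIM('a)" .
  qed
  then show ?thesis by (rule LIMSEQ_unique[OF lim[unfolded eq]])
qed

section \<open>The weighted Hardy inequality\<close>

lemma continuous_on_norm_powr_mult:
  fixes f :: "'a::real_normed_vector \<Rightarrow> real"
  assumes "continuous_on UNIV f" "closed S" "0 \<notin> S" "\<And>x. x \<notin> S \<Longrightarrow> f x = 0"
  shows "continuous_on UNIV (\<lambda>x. norm x powr c * f x)"
proof -
  \<comment> \<open>The weight may be singular at the origin, but the origin lies in the open set
    \<open>- S\<close>, where the product is identically zero.\<close>
  have "continuous_on (- {0} \<union> - S) (\<lambda>x. norm x powr c * f x)"
  proof (rule continuous_on_open_Un)
    show "continuous_on (- {0}) (\<lambda>x. norm x powr c * f x)"
      by (intro continuous_intros continuous_on_subset[OF assms(1)]) auto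
    have "continuous_on (- S) (\<lambda>x. norm x powr c * f x) = continuous_on (- S) (\<lambda>x. 0::real)"
      using assms(4) by (intro continuous_on_cong) auto
    then show "continuous_on (- S) (\<lambda>x. norm x powr c * f x)" by simp
  qed (use assms in auto)
  also have "- {0} \<union> - S = UNIV" using assms by auto
  finally show ?thesis .
qed

text \<open>The exponent \<open>m + 2\<close> gives a formula without a sign function that is valid
  at zero too; there the difference quotient is \<open>\<bar>h\<bar> ^ m * h\<close>, which tends to
  0.\<close>

lemma DERIV_abs_power:
  "((\<lambda>t. \<bar>t\<bar> ^ (m + 2)) has_real_derivative real (m + 2) * \<bar>t\<bar> ^ m * t) (at t)"
proof (cases "t = 0")
  case True
  have "\<bar>h\<bar> ^ (m + 2) = \<bar>h\<bar> ^ m * h * h" for h :: real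
    by (simp only: power_add power2_abs power2_eq_square mult.assoc)
  then have "(\<lambda>h::real. (\<bar>0 + h\<bar> ^ (m + 2) - \<bar>0\<bar> ^ (m + 2)) / h) = (\<lambda>h. \<bar>h\<bar> ^ m * h)"
    by (simp add: fun_eq_iff power_0_left del: power_Suc add_2_eq_Suc')
  moreover have "((\<lambda>h::real. \<bar>h\<bar> ^ m * h) \<longlongrightarrow> \<bar>0\<bar> ^ m * 0) (at 0)"
    by (intro tendsto_intros)
  ultimately show ?thesis using True by (simp only: DERIV_def mult_zero_right)
next
  case False
  then have "(norm has_real_derivative sgn t) (at t)"
    by (metis GDERIV_norm gderiv_deriv)
  from DERIV_power[OF this, of "m + 2"]
  have "((\<lambda>t. \<bar>t\<bar> ^ (m + 2)) has_real_derivative real (m + 2) * \<bar>t\<bar> ^ m * (\<bar>t\<bar> * sgn t)) (at t)"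
    by (simp add: mult_ac)
  then show ?thesis by (simp only: abs_mult_sgn)
qed

text \<open>A crude Young inequality: replace the smaller of the two numbers by the larger.\<close>

lemma power_mult_le_add_powers:
  fixes s t :: real
  assumes "s \<ge> 0" "t \<ge> 0"
  shows "t ^ m * s \<le> t ^ Suc m + s ^ Suc m"
proof (cases "s \<le> t")
  case True
  then have "t ^ m * s \<le> t ^ m * t" using assms by (intro mult_left_mono) auto
  then show ?thesis using assms by (simp add: mult.commute add_increasing2)
next
  case False
  then have "t ^ m * s \<le> s ^ m * s" using assms by (intro mult_right_mono power_mono) auto
  then show ?thesis using assms by (simp add: mult.commute add_increasing)
qed

text \<open>The complement of \<open>S\<close> is open, so \<open>w\<close> is locally constant
  there. This passes vanishing off the support on to derivatives.\<close>

lemma vanishing_imp_grad_eq_0: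
  assumes "closed S" "\<And>x. x \<notin> S \<Longrightarrow> w x = 0" "x \<notin> S"
  shows "grad w x = 0"
proof (rule GDERIV_imp_grad_eq, unfold gderiv_def)
  have "((\<lambda>_. 0) has_derivative (\<lambda>_. 0)) (at x)" by simp
  then have "(w has_derivative (\<lambda>_. 0)) (at x)"
    by (rule has_derivative_transform_within_open[where s="- S"]) (use assms in auto)
  then show "(w has_derivative (\<lambda>h. inner h 0)) (at x)" by simp
qed

lemma hardy_punctured:
  fixes w :: "real ^ 'n \<Rightarrow> real" and c :: real
  assumes w: "w differentiable_on UNIV" "continuous_on UNIV (grad w)"
    and S: "compact S" "0 \<notin> S" "\<And>x. x \<notin> S \<Longrightarrow> w x = 0"
    and p: "p \<ge> 2" and c: "c + CARD('n) \<noteq> 0"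
  shows "(LINT x|lborel. norm x powr c * \<bar>w x\<bar> ^ p)
    \<le> (2 * p / \<bar>c + CARD('n)\<bar>) ^ p * (LINT x|lborel. norm x powr (c + p) * norm (grad w x) ^ p)"
    (is "?A \<le> _ * ?B")
proof -
  obtain m where m: "p = m + 2" using p by (metis add.commute le_Suc_ex)
  have Sc: "closed S" using S(1) by (rule compact_imp_closed)
  have wc: "continuous_on UNIV w" using w(1) by (rule differentiable_imp_continuous_on)
  have gr0: "grad w x = 0" if "x \<notin> S" for x
    using vanishing_imp_grad_eq_0[OF Sc S(3) that] .
  \<comment> \<open>The radial derivative of \<open>f\<close> is \<open>c * f + g\<close>: the
    weight is homogeneous of degree \<open>c\<close>, and \<open>g\<close> comes from
    differentiating \<open>\<bar>w\<bar> ^ p\<close>. The integrand on the right of the inequality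
    is \<open>b\<close>.\<close>
  define f where "f x = norm x powr c * \<bar>w x\<bar> ^ p" for x
  define g where "g x = norm x powr c * (p * \<bar>w x\<bar> ^ m * w x * inner x (grad w x))" for x
  define b where "b x = norm x powr (c + p) * norm (grad w x) ^ p" for x
  have cont: "continuous_on UNIV f" "continuous_on UNIV g" "continuous_on UNIV b"
    unfolding f_def g_def b_def using S(2,3) gr0 p
    by (intro continuous_on_norm_powr_mult[OF _ Sc] continuous_intros wc w(2); simp)+
  have zero: "f x = 0" "g x = 0" "b x = 0" if "x \<notin> S" for x
    using S(3)[OF that] gr0[OF that] p by (auto simp: f_def g_def b_def)
  have int: "integrable lborel f" "integrable lborel g" "integrable lborel b"
    using integrable_continuous_compact_support[OF _ S(1)] cont zero by blast+
  have "((\<lambda>t. f (t *\<^sub>R x)) has_real_derivative c * f x + g x) (at 1)" for x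
  proof (cases "x = 0")
    \<comment> \<open>The ray through the origin is constant, and \<open>f\<close> and
      \<open>g\<close> vanish there because the origin is outside \<open>S\<close>.\<close>
    case True
    then show ?thesis using zero[of 0] S(2) by simp
  next
    case False
    have D1: "((\<lambda>t. norm (t *\<^sub>R x)) has_real_derivative norm x) (at 1)"
      using GDERIV_imp_radial_deriv[OF GDERIV_norm[OF False]]
      using False by (simp add: sgn_div_norm dot_square_norm power2_eq_square flip: mult.assoc)
    have D2: "((\<lambda>t. w (t *\<^sub>R x)) has_real_derivative inner x (grad w x)) (at 1)"
      using w(1) by (intro GDERIV_imp_radial_deriv GDERIV_grad)
        (simp add: differentiable_on_def)
    have D3: "((\<lambda>t. norm (t *\<^sub>R x) powr c) has_real_derivative c * norm x powr c) (at 1)"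
      using DERIV_fun_powr[OF D1, of c] False
      by (simp add: powr_diff)
    have D4: "((\<lambda>t. \<bar>w (t *\<^sub>R x)\<bar> ^ p) has_real_derivative
        p * \<bar>w x\<bar> ^ m * w x * inner x (grad w x)) (at 1)"
      using DERIV_chain2[OF DERIV_abs_power D2] by (simp add: m)
    from DERIV_mult[OF D3 D4] show ?thesis
      unfolding f_def g_def by (simp add: algebra_simps)
  qed
  then have "(LINT x|lborel. c * f x + g x) = - real DIM(real ^ 'n) * integral\<^sup>L lborel f"
    using cont zero S(1) by (intro integral_radial_deriv) (auto intro!: continuous_intros)
  then have euler: "(c + CARD('n)) * integral\<^sup>L lborel f = - integral\<^sup>L lborel g"
    using int by (simp add: algebra_simps)
  \<comment> \<open>With this choice \<open>p * d\<close> is half of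
    \<open>\<bar>c + CARD('n)\<bar>\<close>, so the multiple of the integral of \<open>f\<close>
    produced by the Young bound can be absorbed on the left.\<close>
  define d where "d = \<bar>c + CARD('n)\<bar> / (2 * p)"
  have d: "d > 0" "\<bar>c + CARD('n)\<bar> = 2 * p * d" using c p by (auto simp: d_def)
  have bound: "\<bar>g x\<bar> \<le> p * d * (f x + (1 / d) ^ p * b x)" for x
  proof (cases "x = 0")
    case True
    then show ?thesis using zero[of 0] S(2) by simp
  next
    case False
    let ?s = "norm x * norm (grad w x) / d"
    have Suc_m: "Suc (Suc m) = p" using m by simp
    have s_power: "?s ^ Suc (Suc m) = (1 / d) ^ p * (norm x ^ p * norm (grad w x) ^ p)"
      unfolding Suc_m by (simp add: power_divide power_mult_distrib)
    have pw: "norm x powr (c + p) = norm x powr c * norm x ^ p"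
      using False by (simp add: powr_add powr_realpow)
    have "\<bar>g x\<bar> = norm x powr c * (p * (\<bar>w x\<bar> ^ Suc m * \<bar>inner x (grad w x)\<bar>))"
      by (simp add: g_def abs_mult power_abs mult_ac)
    also have "\<dots> \<le> norm x powr c * (p * (\<bar>w x\<bar> ^ Suc m * (norm x * norm (grad w x))))"
      by (intro mult_left_mono Cauchy_Schwarz_ineq2) auto
    \<comment> \<open>Dividing the gradient factor by \<open>d\<close> before applying Young leaves
      the small coefficient \<open>d\<close> in front of \<open>f\<close> and moves the cost
      \<open>(1 / d) ^ p\<close> onto \<open>b\<close>.\<close>
    also have "\<dots> = norm x powr c * (p * d * (\<bar>w x\<bar> ^ Suc m * ?s))"
      using d(1) by simp
    also have "\<dots> \<le> norm x powr c * (p * d * (\<bar>w x\<bar> ^ Suc (Suc m) + ?s ^ Suc (Suc m)))"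
      using d(1) by (intro mult_left_mono power_mult_le_add_powers) auto
    also have "\<dots> = p * d * (f x + (1 / d) ^ p * b x)"
      unfolding f_def b_def pw s_power unfolding Suc_m by (simp add: algebra_simps)
    finally show ?thesis .
  qed
  have "2 * p * d * integral\<^sup>L lborel f = \<bar>(c + CARD('n)) * integral\<^sup>L lborel f\<bar>"
    using d by (simp add: abs_mult f_def integral_nonneg)
  also have "\<dots> = \<bar>integral\<^sup>L lborel g\<bar>" unfolding euler by simp
  also have "\<dots> \<le> (LINT x|lborel. \<bar>g x\<bar>)" using integral_abs_bound by blast
  also have "\<dots> \<le> (LINT x|lborel. p * d * (f x + (1 / d) ^ p * b x))"
    using int bound by (intro integral_mono) auto
  also have "\<dots> = p * d * (integral\<^sup>L lborel f + (1 / d) ^ p * integral\<^sup>L lborel b)"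
    using int by simp
  \<comment> \<open>Absorption: one of the two copies of
    \<open>p * d * integral\<^sup>L lborel f\<close> on the left cancels the copy on the
    right.\<close>
  finally have "p * d * integral\<^sup>L lborel f \<le> p * d * ((1 / d) ^ p * integral\<^sup>L lborel b)"
    by (simp add: algebra_simps)
  then have "integral\<^sup>L lborel f \<le> (1 / d) ^ p * integral\<^sup>L lborel b"
    using d(1) p by (simp only: mult_le_cancel_left_pos mult_pos_pos of_nat_0_less_iff)
  also have "1 / d = 2 * p / \<bar>c + CARD('n)\<bar>" by (simp add: d_def)
  finally show ?thesis by (simp only: f_def b_def of_nat_mult of_nat_numeral)
qed

section \<open>Pointwise bounds for gradients and powers of norms\<close>

lemma norm_grad_divide_norm_le:
  fixes u :: "real ^ 'n \<Rightarrow> real"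
  assumes "u differentiable (at x)" "x \<noteq> 0"
  shows "norm (grad (\<lambda>y. u y / norm y) x) \<le> norm (grad u x) / norm x + \<bar>u x\<bar> / norm x ^ 2"
proof -
  have "GDERIV (\<lambda>y. u y * inverse (norm y)) x :>
      u x *\<^sub>R (- (inverse (norm x))\<^sup>2 *\<^sub>R sgn x) + inverse (norm x) *\<^sub>R grad u x"
    using assms by (intro GDERIV_mult GDERIV_grad GDERIV_inverse GDERIV_norm) auto
  then have "grad (\<lambda>y. u y / norm y) x =
      u x *\<^sub>R (- (inverse (norm x))\<^sup>2 *\<^sub>R sgn x) + inverse (norm x) *\<^sub>R grad u x"
    by (simp add: GDERIV_imp_grad_eq divide_inverse)
  also have "norm \<dots> \<le> norm (u x *\<^sub>R (- (inverse (norm x))\<^sup>2 *\<^sub>R sgn x))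
      + norm (inverse (norm x) *\<^sub>R grad u x)" by (rule norm_triangle_ineq)
  also have "\<dots> = norm (grad u x) / norm x + \<bar>u x\<bar> / norm x ^ 2"
    using assms by (simp add: norm_sgn divide_inverse power_inverse abs_mult mult.commute)
  finally show ?thesis .
qed

lemma add_power_le:
  fixes s t :: real
  assumes "s \<ge> 0" "t \<ge> 0"
  shows "(s + t) ^ p \<le> 2 ^ p * (s ^ p + t ^ p)"
proof -
  have "(s + t) ^ p \<le> (2 * max s t) ^ p" using assms by (intro power_mono) auto
  also have "\<dots> \<le> 2 ^ p * (s ^ p + t ^ p)"
    using assms by (auto simp: power_mult_distrib max_def)
  finally show ?thesis .
qed

text \<open>The norm is at most \<open>CARD('n)\<close> times the largest absolute component, whose
  power is one of the summands.\<close>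

lemma norm_power_le_sum_power:
  fixes v :: "real ^ 'n"
  shows "norm v ^ p \<le> CARD('n) ^ p * (\<Sum>i\<in>UNIV. \<bar>v $ i\<bar> ^ p)"
proof -
  obtain k where k: "\<And>i. \<bar>v $ i\<bar> \<le> \<bar>v $ k\<bar>"
  proof -
    have "Max (range (\<lambda>i. \<bar>v $ i\<bar>)) \<in> range (\<lambda>i. \<bar>v $ i\<bar>)" by (rule Max_in) auto
    then obtain k where "Max (range (\<lambda>i. \<bar>v $ i\<bar>)) = \<bar>v $ k\<bar>" by blast
    then show thesis using that[of k] Max_ge[of "range (\<lambda>i. \<bar>v $ i\<bar>)"] by auto
  qed
  have "norm v \<le> (\<Sum>i\<in>UNIV. \<bar>v $ i\<bar>)" by (rule norm_le_l1_cart)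
  also have "\<dots> \<le> CARD('n) * \<bar>v $ k\<bar>" using k by (intro sum_bounded_above) auto
  finally have "norm v ^ p \<le> (CARD('n) * \<bar>v $ k\<bar>) ^ p" by (intro power_mono) auto
  also have "\<dots> \<le> CARD('n) ^ p * (\<Sum>i\<in>UNIV. \<bar>v $ i\<bar> ^ p)"
    by (auto simp: power_mult_distrib intro!: mult_left_mono member_le_sum)
  finally show ?thesis .
qed

text \<open>In \<open>hessian\<close> the row index belongs to the outer derivative, so this
  gradient is a column, that is, a row of the transpose, which has the same Frobenius norm.\<close>

lemma norm_grad_partial_deriv_le:
  "norm (grad (partial_deriv i u) x) \<le> norm (hessian u x)"
proof -
  have "norm (grad (partial_deriv i u) x) = norm (transpose (hessian u x) $ i)"
    by (simp add: grad_def hessian_def transpose_def)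
  also have "\<dots> \<le> norm (transpose (hessian u x))" by (rule Finite_Cartesian_Product.norm_nth_le)
  also have "\<dots> = sqrt (\<Sum>i\<in>UNIV. \<Sum>j\<in>UNIV. (hessian u x $ j $ i)\<^sup>2)"
    by (simp add: norm_vec_def L2_set_def transpose_def sum_nonneg)
  also have "\<dots> = norm (hessian u x)"
    by (subst sum.swap) (simp add: norm_vec_def L2_set_def sum_nonneg)
  finally show ?thesis .
qed

lemma Ck_1_imp_continuous_grad:
  assumes "Ck 1 w"
  shows "continuous_on UNIV (grad w)"
  using assms by (auto simp: grad_def[abs_def] intro!: continuous_intros)

section \<open>Two applications of Hardy: from the function to its gradient, and from the gradient
  to the Hessian\<close>

theorem theorem1p1:
  fixes a :: real
  assumes "CARD('n::finite) \<ge> 2"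
    and "a \<in> {..<0} \<union> {0<..<1}"
  shows "\<exists>C>0. \<forall>u\<in>(test_functions_punctured :: (real ^ 'n \<Rightarrow> real) set).
    (LINT x|lborel. norm (grad (\<lambda>y. u y / norm y) x) ^ CARD('n) * norm x powr a)
      \<le> C * (LINT x|lborel. norm (hessian u x) ^ CARD('n) * norm x powr a)"
proof -
  define n where "n = CARD('n)"
  have n: "n \<ge> 2" and a: "a \<noteq> 0" "a < 1" using assms by (auto simp: n_def)
  \<comment> \<open>The Hardy constants with \<open>p = n\<close> for the weights
    \<open>a - 2 * n\<close> and \<open>a - n\<close>. Their denominators are
    \<open>\<bar>a - n\<bar>\<close> and \<open>\<bar>a\<bar>\<close>, nonzero because
    \<open>a < 1 < n\<close> and \<open>a \<noteq> 0\<close>.\<close>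
  define K1 where "K1 = (2 * n / \<bar>(a - 2 * n) + n\<bar>) ^ n"
  define K2 where "K2 = (2 * n / \<bar>(a - n) + n\<bar>) ^ n"
  have K: "K1 > 0" "K2 > 0" using n a by (auto simp: K1_def K2_def)
  \<comment> \<open>The factor \<open>2 ^ n\<close> splits the gradient of the quotient,
    \<open>1 + K1\<close> reduces \<open>u\<close> to its gradient, \<open>n ^ n\<close> passes to
    components, and \<open>n * K2\<close> sums Hardy over the \<open>n\<close> partial
    derivatives.\<close>
  define C where "C = 2 ^ n * ((1 + K1) * (real n ^ n * (n * K2)))"
  have "(LINT x|lborel. norm (grad (\<lambda>y. u y / norm y) x) ^ n * norm x powr a)
      \<le> C * (LINT x|lborel. norm (hessian u x) ^ n * norm x powr a)"
    if "u \<in> test_functions_punctured" for u :: "real ^ 'n \<Rightarrow> real"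
  proof -
    define S where "S = support u"
    have S: "compact S" "0 \<notin> S" and Ck: "Ck k u" for k
      using that by (auto simp: test_functions_punctured_def S_def)
    have Sc: "closed S" using S(1) by (rule compact_imp_closed)
    have u0: "u x = 0" if "x \<notin> S" for x
      using that closure_subset[of "{x. u x \<noteq> 0}"] by (auto simp: S_def support_def)
    have gu0: "grad u x = 0" if "x \<notin> S" for x
      using vanishing_imp_grad_eq_0[OF Sc u0 that] .
    then have pu0: "partial_deriv i u x = 0" if "x \<notin> S" for i x
      using that by (simp add: grad_def vec_eq_iff)
    have "grad (partial_deriv i u) x = 0" if "x \<notin> S" for i x
      using vanishing_imp_grad_eq_0[OF Sc pu0 that] .
    then have hu0: "hessian u x = 0" if "x \<notin> S" for x
      using that by (simp add: hessian_def grad_def vec_eq_iff)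
    have ud: "u differentiable_on UNIV" using Ck[of 1] by simp
    have pd: "partial_deriv i u differentiable_on UNIV" "Ck 1 (partial_deriv i u)" for i
      using Ck[of 2] by (auto simp: numeral_2_eq_2)
    have guc: "continuous_on UNIV (grad u)" using Ck by (rule Ck_1_imp_continuous_grad)
    have gpc: "continuous_on UNIV (grad (partial_deriv i u))" for i
      using pd(2) by (rule Ck_1_imp_continuous_grad)
    have huc: "continuous_on UNIV (hessian u)"
      using Ck[of 2] by (auto simp: hessian_def[abs_def] numeral_2_eq_2 intro!: continuous_intros)
    \<comment> \<open>Every integrand below is a power of the norm times a continuous function
      vanishing off \<open>S\<close>, hence integrable.\<close>
    note weighted = integrable_continuous_compact_support[OF continuous_on_norm_powr_mult[OF _ Sc S(2)] S(1)]

    define I where "I = (LINT x|lborel. norm x powr a * norm (hessian u x) ^ n)"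
    define G where "G = (LINT x|lborel. norm x powr (a - n) * norm (grad u x) ^ n)"
    define U where "U = (LINT x|lborel. norm x powr (a - 2 * n) * \<bar>u x\<bar> ^ n)"
    have I_int: "integrable lborel (\<lambda>x. norm x powr a * norm (hessian u x) ^ n)"
      using n hu0 by (intro weighted continuous_intros huc) auto
    have G_int: "integrable lborel (\<lambda>x. norm x powr (a - n) * norm (grad u x) ^ n)"
      using n gu0 by (intro weighted continuous_intros guc) auto
    have U_int: "integrable lborel (\<lambda>x. norm x powr (a - 2 * n) * \<bar>u x\<bar> ^ n)"
      using n u0 by (intro weighted continuous_intros differentiable_imp_continuous_on[OF ud]) auto
    have P_int: "integrable lborel (\<lambda>x. norm x powr (a - n) * \<bar>partial_deriv i u x\<bar> ^ n)" for i
      using n pu0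
      by (intro weighted continuous_intros differentiable_imp_continuous_on[OF pd(1)]) auto

    have P_le: "(LINT x|lborel. norm x powr (a - n) * \<bar>partial_deriv i u x\<bar> ^ n) \<le> K2 * I" for i
    proof -
      have "(LINT x|lborel. norm x powr (a - n) * \<bar>partial_deriv i u x\<bar> ^ n)
          \<le> K2 * (LINT x|lborel. norm x powr a * norm (grad (partial_deriv i u) x) ^ n)"
        using hardy_punctured[OF pd(1) gpc S pu0 n, of "a - n"] a by (simp add: K2_def n_def)
      also have "\<dots> \<le> K2 * I"
        unfolding I_def using K(2) I_int
        by (intro mult_left_mono integral_mono' power_mono norm_grad_partial_deriv_le) auto
      finally show ?thesis .
    qed
    have "G \<le> (LINT x|lborel. real n ^ n *
        (\<Sum>i\<in>UNIV. norm x powr (a - n) * \<bar>partial_deriv i u x\<bar> ^ n))"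
      unfolding G_def
    proof (rule integral_mono[OF G_int])
      show "integrable lborel (\<lambda>x. real n ^ n *
          (\<Sum>i\<in>UNIV. norm x powr (a - n) * \<bar>partial_deriv i u x\<bar> ^ n))"
        using P_int by auto
      show "norm x powr (a - n) * norm (grad u x) ^ n \<le> real n ^ n *
          (\<Sum>i\<in>UNIV. norm x powr (a - n) * \<bar>partial_deriv i u x\<bar> ^ n)" for x
        using mult_left_mono[OF norm_power_le_sum_power[of "grad u x" n], of "norm x powr (a - n)"]
        by (simp add: grad_def n_def sum_distrib_left mult_ac)
    qed
    also have "\<dots> = real n ^ n *
        (\<Sum>i\<in>UNIV. LINT x|lborel. norm x powr (a - n) * \<bar>partial_deriv i u x\<bar> ^ n)"
      using P_int by (simp add: Bochner_Integration.integral_sum)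
    also have "\<dots> \<le> real n ^ n * (n * (K2 * I))"
    proof (intro mult_left_mono)
      have "(\<Sum>i\<in>UNIV. LINT x|lborel. norm x powr (a - n) * \<bar>partial_deriv i u x\<bar> ^ n)
          \<le> real (card (UNIV :: 'n set)) * (K2 * I)"
        by (rule sum_bounded_above) (rule P_le)
      then show "(\<Sum>i\<in>UNIV. LINT x|lborel. norm x powr (a - n) * \<bar>partial_deriv i u x\<bar> ^ n)
          \<le> n * (K2 * I)"
        by (simp only: n_def)
    qed simp
    finally have G_le: "G \<le> real n ^ n * (n * K2) * I" by (simp add: mult_ac)
    have U_le: "U \<le> K1 * G"
      using hardy_punctured[OF ud guc S u0 n, of "a - 2 * n"] a n
      by (simp add: K1_def n_def U_def G_def algebra_simps)

    have "(LINT x|lborel. norm (grad (\<lambda>y. u y / norm y) x) ^ n * norm x powr a)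
      \<le> (LINT x|lborel. 2 ^ n * (norm x powr (a - n) * norm (grad u x) ^ n
          + norm x powr (a - 2 * n) * \<bar>u x\<bar> ^ n))"
    \<comment> \<open>This rule asks for integrability of the nonnegative majorant only.\<close>
    proof (rule integral_mono')
      show "integrable lborel (\<lambda>x. 2 ^ n * (norm x powr (a - n) * norm (grad u x) ^ n
          + norm x powr (a - 2 * n) * \<bar>u x\<bar> ^ n))"
        using G_int U_int by auto
    next
      fix x :: "real ^ 'n"
      show "norm (grad (\<lambda>y. u y / norm y) x) ^ n * norm x powr a
        \<le> 2 ^ n * (norm x powr (a - n) * norm (grad u x) ^ n
          + norm x powr (a - 2 * n) * \<bar>u x\<bar> ^ n)"
      proof (cases "x = 0")
        \<comment> \<open>Since \<open>0 powr a = 0\<close>, both sides vanish at the origin,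
          whatever value \<open>grad\<close> takes there.\<close>
        case True
        then show ?thesis by simp
      next
        case False
        have "norm (grad (\<lambda>y. u y / norm y) x) ^ n
            \<le> (norm (grad u x) / norm x + \<bar>u x\<bar> / norm x ^ 2) ^ n"
          using ud False
          by (intro power_mono norm_grad_divide_norm_le) (auto simp: differentiable_on_def)
        also have "\<dots> \<le> 2 ^ n * ((norm (grad u x) / norm x) ^ n + (\<bar>u x\<bar> / norm x ^ 2) ^ n)"
          by (rule add_power_le) auto
        finally have "norm (grad (\<lambda>y. u y / norm y) x) ^ n * norm x powr a
            \<le> 2 ^ n * ((norm (grad u x) / norm x) ^ n + (\<bar>u x\<bar> / norm x ^ 2) ^ n) * norm x powr a"
          by (rule mult_right_mono) auto
        moreover have "norm x powr (a - n) = norm x powr a / norm x ^ n"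
          using False by (simp add: powr_diff powr_realpow)
        moreover have "norm x powr (a - 2 * n) = norm x powr a / (norm x ^ 2) ^ n"
          using False powr_realpow[of "norm x" "2 * n"] by (simp add: powr_diff power_mult)
        ultimately show ?thesis by (simp add: power_divide algebra_simps)
      qed
    qed auto
    also have "\<dots> = 2 ^ n * (G + U)"
      using G_int U_int by (simp add: G_def U_def)
    also have "\<dots> \<le> 2 ^ n * ((1 + K1) * G)"
      using U_le by (simp add: algebra_simps)
    also have "\<dots> \<le> 2 ^ n * ((1 + K1) * (real n ^ n * (n * K2) * I))"
      using G_le K(1) by (intro mult_left_mono) auto
    also have "\<dots> = C * (LINT x|lborel. norm (hessian u x) ^ n * norm x powr a)"
      by (simp add: C_def I_def mult_ac)
    finally show ?thesis .
  qed
  moreover have "C > 0" using K n by (simp add: C_def)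
  ultimately show ?thesis unfolding n_def by blast
qed

end
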